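(* Let $\gamma>0$, $p>0$, $\eta>1$ and $\beta\in(-\infty,p\gamma)$, and let $f_{\beta,\gamma,p,\eta}$ be the probability density function of the incomplete gamma distribution $\mathrm{IGa}(\beta,\gamma,p,\eta)$. Then for $u>0$ $$ f_{\beta,\gamma,p,\eta}(u) =\int_1^{\eta^{1/p}} g_{(p\gamma-\beta),p,\theta^p}(u)\, m_{\beta,\gamma,p,\eta}(\theta)\,d\theta, $$ where $$ m_{\beta,\gamma,p,\eta}(\theta) = \frac{p}{K^*_{\beta,\gamma,p,\eta}} (\theta^p-1)^{\gamma-1}\theta^{p+\beta-p\gamma-1}, \qquad 1<\theta<\eta^{1/p}. $$
   Context: For $a,p,\theta>0$, the generalized gamma density is $$g_{a,p,\theta}(u)=\frac{p\,\theta^{a/p}}{\Gamma(a/p)}u^{a-1}e^{-u^p\theta},\quad u>0.$$ (Thus $g_{a,p,\theta^p}$ denotes this density with third parameter $\theta^p$.) For $u>0$, $\gamma>0$ let $G_\gamma(u)=\frac{1}{\Gamma(\gamma)}\int_0^u x^{\gamma-1}e^{-x}\,dx$. The incomplete gamma distribution $\mathrm{IGa}(\beta,\gamma,p,\eta)$ has probability density function $$ f_{\beta,\gamma,p,\eta}(u)=\frac{1}{K_{\beta,\gamma,p,\eta}}G_\gamma(u^p(\eta-1))e^{-u^p}u^{-1-\beta},\quad u>0, $$ where $K_{\beta,\gamma,p,\eta}$ is the normalizing constant $$ K_{\beta,\gamma,p,\eta}=\frac{\Gamma(\gamma-\beta/p)}{p\,\Gamma(\gamma)}K^*_{\beta,\gamma,p,\eta},\qquad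 K^*_{\beta,\gamma,p,\eta}=\int_{1/\eta}^1(1-x)^{\gamma-1}x^{-\beta/p-1}\,dx=\int_1^\eta (x-1)^{\gamma-1}x^{\beta/p-\gamma}\,dx. $$ *)

theory Defs
  imports "HOL-Analysis.Analysis"
begin

text \<open>
  The densities are extended by zero outside the range on which they are specified.
  All integrals are Lebesgue integrals over open intervals, since some integrands are
  singular at an end point (when \<open>\<gamma> < 1\<close>).
\<close>

definition gen_gamma_density :: "real \<Rightarrow> real \<Rightarrow> real \<Rightarrow> real \<Rightarrow> real" where
  "gen_gamma_density a p \<theta> u =
     (if 0 < u then p * \<theta> powr (a / p) / Gamma (a / p) * u powr (a - 1) * exp (- (u powr p) * \<theta>)
      else 0)"

definition inc_gamma_cdf :: "real \<Rightarrow> real \<Rightarrow> real" where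
  "inc_gamma_cdf \<gamma> u = 1 / Gamma \<gamma> * (LBINT x:{0<..<u}. x powr (\<gamma> - 1) * exp (- x))"

definition IGa_Kstar :: "real \<Rightarrow> real \<Rightarrow> real \<Rightarrow> real \<Rightarrow> real" where
  "IGa_Kstar \<beta> \<gamma> p \<eta> =
     (LBINT x:{1 / \<eta><..<1}. (1 - x) powr (\<gamma> - 1) * x powr (- \<beta> / p - 1))"

definition IGa_K :: "real \<Rightarrow> real \<Rightarrow> real \<Rightarrow> real \<Rightarrow> real" where
  "IGa_K \<beta> \<gamma> p \<eta> = Gamma (\<gamma> - \<beta> / p) / (p * Gamma \<gamma>) * IGa_Kstar \<beta> \<gamma> p \<eta>"

definition IGa_density :: "real \<Rightarrow> real \<Rightarrow> real \<Rightarrow> real \<Rightarrow> real \<Rightarrow> real" where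
  "IGa_density \<beta> \<gamma> p \<eta> u =
     (if 0 < u then
        1 / IGa_K \<beta> \<gamma> p \<eta> * inc_gamma_cdf \<gamma> (u powr p * (\<eta> - 1))
          * exp (- (u powr p)) * u powr (- 1 - \<beta>)
      else 0)"

definition IGa_mixing :: "real \<Rightarrow> real \<Rightarrow> real \<Rightarrow> real \<Rightarrow> real \<Rightarrow> real" where
  "IGa_mixing \<beta> \<gamma> p \<eta> \<theta> =
     (if 1 < \<theta> \<and> \<theta> < \<eta> powr (1 / p) then
        p / IGa_Kstar \<beta> \<gamma> p \<eta> * (\<theta> powr p - 1) powr (\<gamma> - 1)
          * \<theta> powr (p + \<beta> - p * \<gamma> - 1)
      else 0)"

end

theory Submission
  imports Defs
begin

text \<open>
  The substitution \<open>x = u\<^sup>p (\<theta>\<^sup>p - 1)\<close> turns the incomplete gamma integral over \<open>(0, u\<^sup>p (\<eta> - 1))\<close>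
  into the mixture integral over \<open>(1, \<eta>\<^bsup>1/p\<^esup>)\<close>; the normalizing constants then match, since
  the \<open>\<theta>\<close>-powers of the gamma density and of the mixing density combine to \<open>\<theta>\<^bsup>p - 1\<^esup>\<close>.
\<close>

text \<open>Absolute integrability refers to the completed measure \<open>lebesgue\<close>, while
  the integrals to be transformed are over \<open>lborel\<close>; for Borel integrands on Borel sets
  the completion changes no integral.\<close>

lemma set_lborel_integral_eq_lebesgue:
  fixes f :: "'a::euclidean_space \<Rightarrow> real"
  assumes "f \<in> borel_measurable borel" and "S \<in> sets borel"
  shows "(LINT x:S|lborel. f x) = (LINT x:S|lebesgue. f x)"
  using assms by (simp add: set_lebesgue_integral_def integral_completion)

text \<open>
  No integrability is assumed: it holds on one side iff it holds on the other, and otherwise both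
  integrals are 0.
\<close>
lemma set_integral_change_of_variables:
  fixes f g g' :: "real \<Rightarrow> real"
  assumes S: "S \<in> sets borel" and gS: "g ` S \<in> sets borel"
    and deriv: "\<And>x. x \<in> S \<Longrightarrow> (g has_field_derivative g' x) (at x within S)"
    and inj: "inj_on g S"
    and meas: "f \<in> borel_measurable borel" "g \<in> borel_measurable borel" "g' \<in> borel_measurable borel"
  shows "(LBINT x:g ` S. f x) = (LBINT x:S. \<bar>g' x\<bar> * f (g x))"
proof -
  let ?h = "\<lambda>x. \<bar>g' x\<bar> * f (g x)"
  have "f \<circ> g \<in> borel_measurable borel"
    using meas by measurable
  then have h: "?h \<in> borel_measurable borel"
    using meas by (auto simp: o_def)
  \<comment> \<open>\<open>b\<close> stays free: taking it to be the actual value of either integral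
    turns the equivalence into a transfer of integrability in that direction, together with equality
    of the values.\<close>
  have cov: "?h absolutely_integrable_on S \<and> integral S ?h = b \<longleftrightarrow>
      f absolutely_integrable_on g ` S \<and> integral (g ` S) f = b" for b
    by (rule has_absolute_integral_change_of_variables_1'[OF _ deriv inj]) (use S in auto)
  have "(LINT x:g ` S|lebesgue. f x) = (LINT x:S|lebesgue. ?h x)"
  proof (cases "?h absolutely_integrable_on S")
    case True
    then have f: "f absolutely_integrable_on g ` S" and "integral (g ` S) f = integral S ?h"
      using cov by blast+
    then show ?thesis
      using set_lebesgue_integral_eq_integral(2)[OF True] set_lebesgue_integral_eq_integral(2)[OF f]
      by simp
  next
    case False
    then have "\<not> f absolutely_integrable_on g ` S"
      using cov by blast
    with False show ?thesis
      by (simp add: set_integrable_def set_lebesgue_integral_def not_integrable_integral_eq)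
  qed
  then show ?thesis
    using set_lborel_integral_eq_lebesgue[OF meas(1) gS] set_lborel_integral_eq_lebesgue[OF h S]
    by simp
qed

text \<open>The map is increasing and sends the end points 1 and \<eta>^(1/p) to 0 and c(\<eta> -
  1); solving x = c(\<theta>^p - 1) for \<theta> gives the preimage (1 + x/c)^(1/p).\<close>

lemma image_scaled_powr_Ioo:
  fixes c p \<eta> :: real
  assumes "0 < c" "0 < p" "1 < \<eta>"
  shows "(\<lambda>\<theta>. c * (\<theta> powr p - 1)) ` {1<..<\<eta> powr (1 / p)} = {0<..<c * (\<eta> - 1)}"
proof (intro equalityI subsetI)
  fix x assume "x \<in> (\<lambda>\<theta>. c * (\<theta> powr p - 1)) ` {1<..<\<eta> powr (1 / p)}"
  then obtain \<theta> where \<theta>: "1 < \<theta>" "\<theta> < \<eta> powr (1 / p)" and x: "x = c * (\<theta> powr p - 1)"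
    by auto
  have "1 < \<theta> powr p"
    using \<theta> assms by (intro gr_one_powr) auto
  moreover have "\<theta> powr p < (\<eta> powr (1 / p)) powr p"
    using \<theta> assms by (intro powr_less_mono2) auto
  ultimately show "x \<in> {0<..<c * (\<eta> - 1)}"
    using assms x by (simp add: powr_powr)
next
  fix x assume "x \<in> {0<..<c * (\<eta> - 1)}"
  then have x: "0 < x" "1 + x / c < \<eta>" "1 < 1 + x / c"
    using assms by (auto simp: field_simps)
  define \<theta> where "\<theta> = (1 + x / c) powr (1 / p)"
  have "1 < \<theta>"
    unfolding \<theta>_def using x assms by (intro gr_one_powr) auto
  moreover have "\<theta> < \<eta> powr (1 / p)"
    unfolding \<theta>_def using x assms by (intro powr_less_mono2) auto
  moreover have "x = c * (\<theta> powr p - 1)"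
    unfolding \<theta>_def using x assms by (simp add: powr_powr)
  ultimately show "x \<in> (\<lambda>\<theta>. c * (\<theta> powr p - 1)) ` {1<..<\<eta> powr (1 / p)}"
    by auto
qed

text \<open>Used with c = u^p. The factor c of the derivative joins c^(\<gamma> - 1) to give
  c^\<gamma>, and exp c comes from the shift by 1 in \<theta>^p - 1; it later cancels exp(-u^p) in
  \<open>IGa_density\<close>.\<close>

lemma inc_gamma_integral_substitution:
  fixes c p \<gamma> \<eta> :: real
  assumes "0 < c" "0 < p" "1 < \<eta>"
  shows "(LBINT x:{0<..<c * (\<eta> - 1)}. x powr (\<gamma> - 1) * exp (- x)) =
    (LBINT \<theta>:{1<..<\<eta> powr (1 / p)}. c powr \<gamma> * exp c *
       (p * \<theta> powr (p - 1) * (\<theta> powr p - 1) powr (\<gamma> - 1) * exp (- c * \<theta> powr p)))"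
proof -
  let ?S = "{1<..<\<eta> powr (1 / p)}" and ?g = "\<lambda>\<theta>::real. c * (\<theta> powr p - 1)"
  let ?f = "\<lambda>x::real. x powr (\<gamma> - 1) * exp (- x)" and ?g' = "\<lambda>\<theta>::real. c * (p * \<theta> powr (p - 1))"
  have inj: "inj_on ?g ?S"
  proof (rule strict_mono_on_imp_inj_on, rule strict_mono_onI)
    fix r s assume "r \<in> ?S" "s \<in> ?S" "r < s"
    then show "?g r < ?g s"
      using assms by (auto intro!: powr_less_mono2)
  qed
  have "(LBINT x:?g ` ?S. ?f x) = (LBINT \<theta>:?S. \<bar>?g' \<theta>\<bar> * ?f (?g \<theta>))"
    using assms image_scaled_powr_Ioo[OF assms] inj
    by (intro set_integral_change_of_variables) (auto intro!: derivative_eq_intros)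
  also have "\<dots> = (LBINT \<theta>:?S. c powr \<gamma> * exp c *
       (p * \<theta> powr (p - 1) * (\<theta> powr p - 1) powr (\<gamma> - 1) * exp (- c * \<theta> powr p)))"
  proof (intro set_lebesgue_integral_cong allI impI)
    fix \<theta> assume "\<theta> \<in> ?S"
    then have "1 < \<theta> powr p"
      using assms by (intro gr_one_powr) auto
    then have "(c * (\<theta> powr p - 1)) powr (\<gamma> - 1) = c powr (\<gamma> - 1) * (\<theta> powr p - 1) powr (\<gamma> - 1)"
      using assms by (simp add: powr_mult)
    moreover have "c powr \<gamma> = c * c powr (\<gamma> - 1)"
      using assms by (simp add: powr_diff)
    moreover have "exp (- (c * (\<theta> powr p - 1))) = exp c * exp (- c * \<theta> powr p)"
      by (simp add: exp_add[symmetric] algebra_simps)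
    ultimately show "\<bar>?g' \<theta>\<bar> * ?f (?g \<theta>) = c powr \<gamma> * exp c *
       (p * \<theta> powr (p - 1) * (\<theta> powr p - 1) powr (\<gamma> - 1) * exp (- c * \<theta> powr p))"
      using assms by (simp add: abs_mult)
  qed simp
  finally show ?thesis
    using image_scaled_powr_Ioo[OF assms] by simp
qed

theorem lemma2p2:
  fixes \<beta> \<gamma> p \<eta> u :: real
  assumes "0 < \<gamma>" and "0 < p" and "1 < \<eta>" and "\<beta> < p * \<gamma>" and "0 < u"
  shows "IGa_density \<beta> \<gamma> p \<eta> u =
    (LBINT \<theta>:{1<..<\<eta> powr (1 / p)}.
       gen_gamma_density (p * \<gamma> - \<beta>) p (\<theta> powr p) u * IGa_mixing \<beta> \<gamma> p \<eta> \<theta>)"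
proof -
  let ?S = "{1<..<\<eta> powr (1 / p)}"
  \<comment> \<open>Both sides are brought to the form C u^(p\<gamma>) times the integral of
    \<open>h\<close>: \<open>h\<close> carries the dependence on \<theta>, and u^(p\<gamma>) is the
    (u^p)^\<gamma> left by the substitution.\<close>
  define h where "h = (\<lambda>\<theta>. p * \<theta> powr (p - 1) * (\<theta> powr p - 1) powr (\<gamma> - 1)
    * exp (- (u powr p) * \<theta> powr p))"
  define C where "C = p * u powr (- 1 - \<beta>) / (Gamma (\<gamma> - \<beta> / p) * IGa_Kstar \<beta> \<gamma> p \<eta>)"
  have c: "0 < u powr p"
    using assms by simp
  have cdf: "inc_gamma_cdf \<gamma> (u powr p * (\<eta> - 1)) =
      1 / Gamma \<gamma> * (u powr (p * \<gamma>) * exp (u powr p) * (LBINT \<theta>:?S. h \<theta>))"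
    unfolding inc_gamma_cdf_def h_def
    by (simp only: inc_gamma_integral_substitution[OF c assms(2,3)] set_integral_mult_right powr_powr)
  \<comment> \<open>This factor occurs in both \<open>inc_gamma_cdf\<close> and \<open>IGa_K\<close>
    and has to cancel; \<open>Gamma (\<gamma> - \<beta> / p)\<close> and \<open>IGa_Kstar\<close>
    stay in the denominator on both sides.\<close>
  have "Gamma \<gamma> \<noteq> 0"
    using Gamma_real_pos[OF assms(1)] by simp
  then have "IGa_density \<beta> \<gamma> p \<eta> u = C * u powr (p * \<gamma>) * (LBINT \<theta>:?S. h \<theta>)"
    unfolding IGa_density_def cdf IGa_K_def C_def using assms
    by (simp add: exp_minus field_simps)
  also have "\<dots> = (LBINT \<theta>:?S. C * u powr (p * \<gamma>) * h \<theta>)"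
    by (simp only: set_integral_mult_right)
  also have "\<dots> = (LBINT \<theta>:?S.
       gen_gamma_density (p * \<gamma> - \<beta>) p (\<theta> powr p) u * IGa_mixing \<beta> \<gamma> p \<eta> \<theta>)"
  proof (intro set_lebesgue_integral_cong allI impI)
    fix \<theta> assume \<theta>: "\<theta> \<in> ?S"
    have shape: "(p * \<gamma> - \<beta>) / p = \<gamma> - \<beta> / p"
      using assms by (simp add: field_simps)
    have powers: "(\<theta> powr p) powr (\<gamma> - \<beta> / p) * \<theta> powr (p + \<beta> - p * \<gamma> - 1) = \<theta> powr (p - 1)"
    proof -
      have "p * (\<gamma> - \<beta> / p) + (p + \<beta> - p * \<gamma> - 1) = p - 1"
        using assms by (simp add: field_simps)
      then show ?thesis
        by (simp only: powr_powr powr_add[symmetric])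
    qed
    have u: "u powr (p * \<gamma> - \<beta> - 1) = u powr (p * \<gamma>) * u powr (- 1 - \<beta>)"
      by (simp add: powr_add[symmetric] algebra_simps)
    \<comment> \<open>\<open>powers\<close> is applied from right to left: it splits the \<theta>^(p
      - 1) in \<open>h\<close> into the factor of the gamma density and that of the mixing
      density.\<close>
    show "C * u powr (p * \<gamma>) * h \<theta> =
        gen_gamma_density (p * \<gamma> - \<beta>) p (\<theta> powr p) u * IGa_mixing \<beta> \<gamma> p \<eta> \<theta>"
      using \<theta> assms(5) unfolding gen_gamma_density_def IGa_mixing_def shape C_def h_def u
      by (simp add: mult_ac flip: powers)
  qed simp
  finally show ?thesis .
qed

end
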